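(* Suppose $\theta_i=\theta$ for all $i\in[N]$. Then $c$ is weakly concave on $\Lambda$ if $$\underline{\lambda}_i>\theta\,\frac{e_{(4)}}{1-2e_{(4)}},\qquad\forall i\in[N].$$
   Context: Fix an integer $N\ge 1$ and write $[N]=\{1,\dots,N\}$. Costs $c_{(i)}>0$ and $c_{(i,j)}>0$ ($i,j\in[N]$) are given with $c_{(i)}=c_{(i,i)}\le c_{(i,j)}=c_{(j,i)}$ for all $i,j\in[N]$. The parameters $\theta_i>0$ ($i\in[N]$) are given. The domain is the box $\Lambda=[\underline{\boldsymbol{\lambda}},\overline{\boldsymbol{\lambda}}]=\{\boldsymbol{\lambda}\in\mathbb{R}^N:\underline{\lambda}_i\le\lambda_i\le\overline{\lambda}_i\ \forall i\}$ with $\underline{\lambda}_i>0$ for all $i$. For $\boldsymbol{\lambda}\in\Lambda$, $c(\boldsymbol{\lambda})$ is the optimal value of the linear program in variables $\boldsymbol{x}=(x_{i,j})_{i,j\in[N]}$, $\boldsymbol{y}=(y_i)_{i\in[N]}$: minimize $\sum_{i,j\in[N]}c_{(i,j)}x_{i,j}+\sum_{i\in[N]}c_{(i)}y_i$ subject to $\sum_{j\in[N]}x_{j,i}+\sum_{j\in[N]}x_{i,j}+y_i=\lambda_i$ for all $i\in[N]$; $\theta_i x_{i,j}\le\lambda_j y_i$ for all $i,j\in[N]$; $x_{i,j}\ge 0$ for all $i,j\in[N]$; $y_i\ge 0$ for all $i\in[N]$. Weak concavity: $c$ is weakly concave on $\Lambda$ if there exists a finite $\rho\ge 0$ such that $\boldsymbol{\lambda}\mapsto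 c(\boldsymbol{\lambda})-\rho\|\boldsymbol{\lambda}\|^2/2$ is concave on $\Lambda$, with $\|\cdot\|$ the Euclidean norm. Matching efficiency: $e_{i,j}=1-c_{(i,j)}/(c_{(i)}+c_{(j)})$ for $i,j\in[N]$ (so $e_{i,i}=0.5$ and $e_{i,j}\le 0.5$). For each $i$, let $e_{i,(1)}\ge e_{i,(2)}\ge\dots\ge e_{i,(N)}$ be the values $e_{i,1},\dots,e_{i,N}$ sorted in descending order. For a positive integer $k$, the $k$-th critical matching efficiency is $e_{(k)}=\max_{i\in[N]}e_{i,(k)}$ if $k\le N$, and $e_{(k)}=0$ if $k>N$. Standing assumption in the homogeneous-patience case: $e_{(k)}<0.5$ for all $k\ge 2$. *)

theory Defs
  imports "HOL-Analysis.Analysis" "HOL-Library.Multiset"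
begin

text \<open>The index set $[N]$ is a finite type \<open>'n\<close> with \<open>N = CARD('n)\<close>;
  \<open>cs i\<close> is $c_{(i)}$ and \<open>cp i j\<close> is $c_{(i,j)}$.\<close>

definition lp_feasible ::
  "('n::finite \<Rightarrow> real) \<Rightarrow> real ^ 'n \<Rightarrow> ((real ^ 'n ^ 'n) \<times> (real ^ 'n)) set"
  where "lp_feasible \<theta> l = {(x, y).
     (\<forall>i. (\<Sum>j\<in>UNIV. x $ j $ i) + (\<Sum>j\<in>UNIV. x $ i $ j) + y $ i = l $ i) \<and>
     (\<forall>i j. \<theta> i * x $ i $ j \<le> l $ j * y $ i) \<and>
     (\<forall>i j. 0 \<le> x $ i $ j) \<and>
     (\<forall>i. 0 \<le> y $ i)}"

definition lp_cost ::
  "('n::finite \<Rightarrow> real) \<Rightarrow> ('n \<Rightarrow> 'n \<Rightarrow> real) \<Rightarrow> (real ^ 'n ^ 'n) \<times> (real ^ 'n) \<Rightarrow> real"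
  where "lp_cost cs cp = (\<lambda>(x, y).
     (\<Sum>i\<in>UNIV. \<Sum>j\<in>UNIV. cp i j * x $ i $ j) + (\<Sum>i\<in>UNIV. cs i * y $ i))"

text \<open>For nonnegative costs and \<open>l \<ge> 0\<close>, the point \<open>x = 0\<close>, \<open>y = l\<close> is
  feasible and the objective is bounded below by 0, so the infimum is a genuine one.\<close>

definition lp_value ::
  "('n::finite \<Rightarrow> real) \<Rightarrow> ('n \<Rightarrow> 'n \<Rightarrow> real) \<Rightarrow> ('n \<Rightarrow> real) \<Rightarrow> real ^ 'n \<Rightarrow> real"
  where "lp_value cs cp \<theta> l = (INF p\<in>lp_feasible \<theta> l. lp_cost cs cp p)"

definition weakly_concave_on :: "'a::real_normed_vector set \<Rightarrow> ('a \<Rightarrow> real) \<Rightarrow> bool"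
  where "weakly_concave_on S f \<longleftrightarrow>
     (\<exists>\<rho>\<ge>0. concave_on S (\<lambda>x. f x - \<rho> * (norm x)\<^sup>2 / 2))"

definition match_eff :: "('n \<Rightarrow> real) \<Rightarrow> ('n \<Rightarrow> 'n \<Rightarrow> real) \<Rightarrow> 'n \<Rightarrow> 'n \<Rightarrow> real"
  where "match_eff cs cp i j = 1 - cp i j / (cs i + cs j)"

text \<open>The $k$-th largest of the $N$ values $e_{i,j}$ ($j \in [N]$), counted with
  multiplicity; meaningful for \<open>1 \<le> k \<le> CARD('n)\<close>.\<close>

definition sorted_match_eff ::
  "('n::finite \<Rightarrow> real) \<Rightarrow> ('n \<Rightarrow> 'n \<Rightarrow> real) \<Rightarrow> 'n \<Rightarrow> nat \<Rightarrow> real"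
  where "sorted_match_eff cs cp i k =
     rev (sorted_list_of_multiset (image_mset (match_eff cs cp i) (mset_set UNIV))) ! (k - 1)"

definition crit_match_eff ::
  "('n::finite \<Rightarrow> real) \<Rightarrow> ('n \<Rightarrow> 'n \<Rightarrow> real) \<Rightarrow> nat \<Rightarrow> real"
  where "crit_match_eff cs cp k =
     (if k \<le> CARD('n) then (MAX i\<in>UNIV. sorted_match_eff cs cp i k) else 0)"

end

theory Submission
  imports Defs
begin

text \<open>
  Write \<open>\<mu> = \<lambda>/\<theta>\<close>. Eliminating the multipliers of the coupling constraints, the dual program is
  to maximise \<open>\<Sum>\<^sub>i \<lambda>\<^sub>i \<alpha>\<^sub>i\<close> subject to \<open>G\<^sub>i(\<alpha>) \<le> c\<^sub>i\<close>, where
  \<open>G\<^sub>i(\<alpha>) = \<alpha>\<^sub>i + \<Sum>\<^sub>j \<mu>\<^sub>j (\<alpha>\<^sub>i + \<alpha>\<^sub>j - c\<^sub>i\<^sub>j)\<^sup>+\<close>. The equation \<open>G(\<alpha>) = c\<close> has a solution, unique and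
  Lipschitz in \<open>\<lambda>\<close>, because \<open>G\<close> expands the maximum norm. The bound on \<open>\<lambda>\<close> forces
  \<open>\<alpha>\<^sub>i < (1 - e\<^sub>4) c\<^sub>i\<close>, so that \<open>\<alpha>\<^sub>i + \<alpha>\<^sub>j > c\<^sub>i\<^sub>j\<close> holds for at most three \<open>j\<close>, one of them being \<open>i\<close>
  itself. This sparsity makes the complementary primal solution nonnegative, so \<open>\<alpha>\<close> is dual
  optimal. Freezing the primal activity pattern at one point \<open>\<lambda>'\<close> of the box gives an upper
  bound for the value at \<open>\<lambda>\<close> that is bilinear in \<open>\<alpha>\<close> and \<open>\<lambda>\<close>; since \<open>\<alpha>\<close> is Lipschitz, it exceeds
  an affine function of \<open>\<lambda>\<close> by at most a multiple of \<open>\<parallel>\<lambda> - \<lambda>'\<parallel>\<^sup>2\<close>, which is weak concavity.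
\<close>

section \<open>Concavity criterion, fixed points and counting\<close>

text \<open>The identity |y|^2 - |x|^2 - |y - x|^2 = 2 x.(y - x) is linear in y - x, so subtracting
  \<open>R * (norm x)\<^sup>2\<close> turns each quadratic upper bound into an affine one. Affine
  majorants touching at every point of a convex set give concavity.\<close>

lemma weakly_concave_onI:
  fixes S :: "'a::real_inner set"
  assumes "convex S" "0 \<le> R"
    and upper: "\<And>x. x \<in> S \<Longrightarrow> \<exists>g. \<forall>y\<in>S. f y \<le> f x + g \<bullet> (y - x) + R * (norm (y - x))\<^sup>2"
  shows "weakly_concave_on S f"
  unfolding weakly_concave_on_def
proof (intro exI conjI)
  show "0 \<le> 2 * R" using assms by simp
  define h where "h x = f x - 2 * R * (norm x)\<^sup>2 / 2" for x
  have super: "\<exists>g. \<forall>y\<in>S. h y \<le> h x + g \<bullet> (y - x)" if "x \<in> S" for x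
  proof -
    from upper[OF that] obtain g
      where g: "\<forall>y\<in>S. f y \<le> f x + g \<bullet> (y - x) + R * (norm (y - x))\<^sup>2" by blast
    have "h y \<le> h x + (g - (2 * R) *\<^sub>R x) \<bullet> (y - x)" if "y \<in> S" for y
      using bspec[OF g that]
      by (simp add: h_def power2_norm_eq_inner inner_diff_left inner_diff_right
          inner_commute algebra_simps)
    then show ?thesis by blast
  qed
  have "u * h x + v * h y \<le> h (u *\<^sub>R x + v *\<^sub>R y)"
    if "x \<in> S" "y \<in> S" "0 \<le> u" "0 \<le> v" "u + v = 1" for x y u v
  proof -
    let ?p = "u *\<^sub>R x + v *\<^sub>R y"
    have "?p \<in> S" using \<open>convex S\<close> that by (simp add: convex_def)
    from super[OF this] obtain g where g: "\<forall>y\<in>S. h y \<le> h ?p + g \<bullet> (y - ?p)" by blast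
    have "u * h x + v * h y \<le> u * (h ?p + g \<bullet> (x - ?p)) + v * (h ?p + g \<bullet> (y - ?p))"
      using g that by (intro add_mono mult_left_mono) auto
    also have "\<dots> = (u + v) * h ?p + g \<bullet> (?p - (u + v) *\<^sub>R ?p)"
      by (simp add: algebra_simps inner_diff_right inner_add_right)
    finally show ?thesis using that by simp
  qed
  then show "concave_on S (\<lambda>x. f x - 2 * R * (norm x)\<^sup>2 / 2)"
    using \<open>convex S\<close> unfolding concave_on_iff h_def by blast
qed

text \<open>Apply Brouwer to the step \<open>v + F v\<close> clamped to the box: a fixed coordinate
  off the lower face has F \<ge> 0, one off the upper face has F \<le> 0. To solve F = 0 it then
  suffices to examine the two faces.\<close>

lemma box_complementarity:
  fixes F :: "('n::finite \<Rightarrow> real) \<Rightarrow> 'n \<Rightarrow> real"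
  assumes b: "\<And>i. 0 \<le> b i"
    and cont: "\<And>i. continuous_on UNIV (\<lambda>v::real^'n. F (($) v) i)"
  obtains z where "\<And>i. 0 \<le> z i" "\<And>i. z i \<le> b i"
    "\<And>i. 0 < z i \<Longrightarrow> 0 \<le> F z i" "\<And>i. z i < b i \<Longrightarrow> F z i \<le> 0"
proof -
  define T :: "real^'n \<Rightarrow> real^'n"
    where "T v = (\<chi> i. max 0 (min (b i) (v $ i + F (($) v) i)))" for v
  define S where "S = cbox (0::real^'n) (\<chi> i. b i)"
  have "continuous_on S T"
    unfolding T_def
    by (intro continuous_intros continuous_on_max continuous_on_min
        continuous_on_subset[OF cont]) auto
  moreover have "T \<in> S \<rightarrow> S" "0 \<in> S"
    using b by (auto simp: S_def T_def mem_box_cart)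
  ultimately obtain v where v: "v \<in> S" "T v = v"
    using brouwer[of S T] by (metis S_def compact_cbox convex_box(1) empty_iff)
  have fix_v: "v $ i = max 0 (min (b i) (v $ i + F (($) v) i))" for i
    using arg_cong[OF v(2), of "\<lambda>w. w $ i"] by (simp add: T_def)
  show thesis
  proof (rule that[of "($) v"])
    fix i
    show "0 \<le> v $ i" "v $ i \<le> b i" using v(1) by (auto simp: S_def mem_box_cart)
    show "0 < v $ i \<Longrightarrow> 0 \<le> F (($) v) i" using fix_v[of i] by linarith
    show "v $ i < b i \<Longrightarrow> F (($) v) i \<le> 0" using fix_v[of i] by linarith
  qed
qed

text \<open>The form in which sparsity enters: at most two terms, each below half of a quantity,
  cannot add up to it. The assumption \<open>0 < t\<close> keeps this strict for empty
  \<open>A\<close>.\<close>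

lemma sum_less_double:
  fixes f :: "'a \<Rightarrow> real"
  assumes "finite A" "card A \<le> 2" "0 < t" "\<And>j. j \<in> A \<Longrightarrow> f j < t"
  shows "sum f A < 2 * t"
proof (cases "A = {}")
  case False
  have "sum f A < (\<Sum>j\<in>A. t)"
    using assms False by (intro sum_strict_mono) auto
  also have "\<dots> = real (card A) * t" by simp
  also have "\<dots> \<le> 2 * t" using assms by (intro mult_right_mono) auto
  finally show ?thesis .
qed (use assms in auto)

text \<open>In a descending list, an entry larger than the one at zero-based position
  \<open>k\<close> stands before it. Counting positions instead of values takes care of
  ties.\<close>

lemma card_greater_nth_largest:
  fixes f :: "'n::finite \<Rightarrow> real"
  defines "xs \<equiv> rev (sorted_list_of_multiset (image_mset f (mset_set UNIV)))"
  shows "card {j. xs ! k < f j} \<le> k"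
proof -
  have mset_xs: "mset xs = image_mset f (mset_set UNIV)"
    by (simp add: xs_def)
  have srt: "sorted (rev xs)"
    by (simp add: xs_def)
  have "{i. i < length xs \<and> xs ! k < xs ! i} \<subseteq> {..<k}"
    using sorted_rev_nth_mono[OF srt, of k] by (force simp: not_less[symmetric])
  then have "card {i. i < length xs \<and> xs ! k < xs ! i} \<le> k"
    using card_mono[of "{..<k}"] by fastforce
  moreover have "card {i. i < length xs \<and> xs ! k < xs ! i} = size (filter_mset ((<) (xs ! k)) (mset xs))"
    by (metis length_filter_conv_card mset_filter size_mset)
  moreover have "size (filter_mset ((<) (xs ! k)) (mset xs)) = card {j. xs ! k < f j}"
    unfolding mset_xs by (simp add: filter_mset_image_mset)
  ultimately show ?thesis by simp
qed

lemma card_greater_crit_match_eff: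
  assumes "crit_match_eff cs cp (Suc k) \<le> v" "k < CARD('n)"
  shows "card {j::'n::finite. v < match_eff cs cp i j} \<le> k"
proof -
  have "sorted_match_eff cs cp i (Suc k) \<le> v"
    using assms by (auto simp: crit_match_eff_def Max_le_iff)
  then have "card {j. v < match_eff cs cp i j} \<le>
      card {j. sorted_match_eff cs cp i (Suc k) < match_eff cs cp i j}"
    by (intro card_mono) auto
  \<comment> \<open>Rank \<open>Suc k\<close>, counted from one, is list position
    \<open>k\<close>.\<close>
  also have "\<dots> \<le> k"
    using card_greater_nth_largest[of "match_eff cs cp i" k] by (simp add: sorted_match_eff_def)
  finally show ?thesis .
qed

section \<open>The dual equation: solvability, stability, self-activity\<close>

locale match_costs =
  fixes cs :: "'n::finite \<Rightarrow> real" and cp :: "'n \<Rightarrow> 'n \<Rightarrow> real"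
  assumes cs_pos: "0 < cs i"
    and cs_diag: "cs i = cp i i"
    and cs_le_cp: "cs i \<le> cp i j"
    and cp_sym: "cp i j = cp j i"
begin

lemma cs_le_cp': "cs j \<le> cp i j"
  using cs_le_cp[of j i] by (simp add: cp_sym)

text \<open>Here \<open>m\<close> is \<lambda>/\<theta>. The positive part divided by \<theta> is
  the least multiplier of the coupling constraint at (i, j) that satisfies the dual constraint of
  the variable \<open>x $ i $ j\<close>.\<close>

definition dual_map :: "('n \<Rightarrow> real) \<Rightarrow> ('n \<Rightarrow> real) \<Rightarrow> 'n \<Rightarrow> real"
  where "dual_map m a i = a i + (\<Sum>j\<in>UNIV. m j * max 0 (a i + a j - cp i j))"

text \<open>These are the pairs with positive multiplier, where complementary slackness calls for a
  tight coupling constraint.\<close>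

definition active :: "('n \<Rightarrow> real) \<Rightarrow> 'n \<Rightarrow> 'n set"
  where "active a i = {j. cp i j < a i + a j}"

lemma active_sym: "j \<in> active a i \<longleftrightarrow> i \<in> active a j"
  by (auto simp: active_def cp_sym add.commute)

lemma dual_map_eq_sum_active:
  "dual_map m a i = a i + (\<Sum>j\<in>active a i. m j * (a i + a j - cp i j))"
proof -
  have "(\<Sum>j\<in>UNIV. m j * max 0 (a i + a j - cp i j)) =
      (\<Sum>j\<in>active a i. m j * (a i + a j - cp i j))"
    by (rule sum.mono_neutral_cong_right) (auto simp: active_def)
  then show ?thesis by (simp add: dual_map_def)
qed

text \<open>Dropping a nonnegative summand, or replacing a positive part by its argument, only
  lowers the sum. The set \<open>A\<close> is free, so that the active set of another point can be
  inserted.\<close>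

lemma dual_map_ge:
  assumes "\<And>j. 0 \<le> m j"
  shows "a i + (\<Sum>j\<in>A. m j * (a i + a j - cp i j)) \<le> dual_map m a i"
proof -
  have "(\<Sum>j\<in>A. m j * (a i + a j - cp i j)) \<le> (\<Sum>j\<in>A. m j * max 0 (a i + a j - cp i j))"
    by (intro sum_mono mult_left_mono assms) auto
  also have "\<dots> \<le> (\<Sum>j\<in>UNIV. m j * max 0 (a i + a j - cp i j))"
    by (intro sum_mono2) (auto simp: assms)
  finally show ?thesis by (simp add: dual_map_def)
qed

text \<open>Complementarity on the box from 0 to \<open>cs\<close>. On the lower face nothing is
  active at \<open>i\<close>, so \<open>dual_map\<close> vanishes there and falls short of
  \<open>cs i\<close>; on the upper face the term \<open>a i\<close> alone already reaches
  \<open>cs i\<close>.\<close>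

lemma dual_map_solution:
  assumes m: "\<And>j. 0 \<le> m j"
  obtains a where "\<And>i. dual_map m a i = cs i" "\<And>i. 0 < a i" "\<And>i. a i \<le> cs i"
proof -
  have cont: "continuous_on UNIV (\<lambda>v::real^'n. cs i - dual_map m (($) v) i)" for i
    unfolding dual_map_def by (intro continuous_intros continuous_on_max)
  obtain a where a: "\<And>i. 0 \<le> a i" "\<And>i. a i \<le> cs i"
    "\<And>i. 0 < a i \<Longrightarrow> 0 \<le> cs i - dual_map m a i"
    "\<And>i. a i < cs i \<Longrightarrow> cs i - dual_map m a i \<le> 0"
    using box_complementarity[of cs "\<lambda>a i. cs i - dual_map m a i"] cont cs_pos
    by (metis less_eq_real_def)
  have pos: "0 < a i" for i
  proof (rule ccontr)
    assume "\<not> 0 < a i"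
    then have "a i = 0" using a(1)[of i] by simp
    moreover have "a j \<le> cp i j" for j
      using a(2) cs_le_cp' by (rule order_trans)
    ultimately have "active a i = {}" by (auto simp: active_def not_less)
    then have "dual_map m a i = 0"
      using \<open>a i = 0\<close> by (simp add: dual_map_eq_sum_active)
    then show False using a(4)[of i] \<open>a i = 0\<close> cs_pos[of i] by simp
  qed
  have "dual_map m a i = cs i" for i
  proof (cases "a i < cs i")
    case False
    then have "cs i \<le> dual_map m a i"
      using dual_map_ge[of m a i "{}"] m by simp
    then show ?thesis using a(3)[OF pos, of i] by simp
  qed (use a(3)[OF pos, of i] a(4)[of i] in simp)
  then show thesis using pos a(2) that by blast
qed

text \<open>This bounds the inverse of \<open>dual_map\<close> in the maximum norm with constant 1,
  for a fixed \<open>m\<close>. It is the source of the Lipschitz dependence of the dual solution on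
  \<lambda>.\<close>

lemma dual_map_expansive:
  assumes m: "\<And>j. 0 \<le> m j" and K: "\<And>j. \<bar>dual_map m a j - dual_map m b j\<bar> \<le> K"
  shows "\<bar>a i - b i\<bar> \<le> K"
proof -
  obtain k where k: "\<And>j. \<bar>a j - b j\<bar> \<le> \<bar>a k - b k\<bar>"
  proof -
    have "Max (range (\<lambda>j. \<bar>a j - b j\<bar>)) \<in> range (\<lambda>j. \<bar>a j - b j\<bar>)"
      by (intro Max_in) auto
    then obtain k where "Max (range (\<lambda>j. \<bar>a j - b j\<bar>)) = \<bar>a k - b k\<bar>" by blast
    moreover have "\<bar>a j - b j\<bar> \<le> Max (range (\<lambda>j. \<bar>a j - b j\<bar>))" for j
      by (intro Max_ge) auto
    ultimately show thesis using that by metis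
  qed
  \<comment> \<open>At a coordinate of maximal distance, no summand of \<open>dual_map\<close> can work against \<open>a k - b k\<close>.\<close>
  have *: "u k - v k \<le> dual_map m u k - dual_map m v k"
    if "\<And>j. \<bar>u j - v j\<bar> \<le> u k - v k" for u v
  proof -
    have "m j * max 0 (v k + v j - cp k j) \<le> m j * max 0 (u k + u j - cp k j)" for j
      using that[of j] by (intro mult_left_mono m) linarith
    then show ?thesis by (simp add: dual_map_def sum_mono)
  qed
  have "\<bar>a k - b k\<bar> \<le> \<bar>dual_map m a k - dual_map m b k\<bar>"
  proof (cases "b k \<le> a k")
    case True
    then show ?thesis using *[of a b] k by fastforce
  next
    case False
    then have "\<And>j. \<bar>b j - a j\<bar> \<le> b k - a k"
      using k by (metis abs_minus_commute abs_of_nonneg diff_ge_0_iff_ge linear)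
    then have "b k - a k \<le> dual_map m b k - dual_map m a k" by (rule *)
    then show ?thesis using False by linarith
  qed
  then show ?thesis using k[of i] K[of k] by linarith
qed

text \<open>If \<open>i\<close> were not active with itself, then \<open>2 * a i \<le> cs i\<close>,
  and the active terms at \<open>i\<close> would have to contribute at least \<open>a i\<close>. The
  equation at each neighbour \<open>j\<close> limits its term to less than \<open>a i / 2\<close>,
  and there are at most two neighbours.\<close>

lemma self_active:
  assumes m: "\<And>j. 0 < m j" and a: "\<And>i. dual_map m a i = cs i" "\<And>i. 0 < a i"
    and card: "card (active a i - {i}) \<le> 2"
  shows "i \<in> active a i"
proof (rule ccontr)
  assume i: "i \<notin> active a i"
  then have half: "2 * a i \<le> cs i" by (simp add: active_def cs_diag)
  have "m j * (a i + a j - cp i j) < a i / 2" if j: "j \<in> active a i" for j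
  proof -
    define w where "w = a i + a j - cp i j"
    have "i \<noteq> j" using i j by auto
    have w: "0 < w" using j by (simp add: w_def active_def)
    \<comment> \<open>The equation at \<open>j\<close>, keeping only the terms of \<open>i\<close>
      and of \<open>j\<close> itself.\<close>
    have "a j + (m i * w + m j * (2 * a j - cs j)) \<le> cs j"
      using dual_map_ge[of m a j "{i, j}"] m \<open>i \<noteq> j\<close> a(1)[of j]
      by (simp add: w_def cs_diag cp_sym[of j i] less_imp_le algebra_simps)
    \<comment> \<open>The self-excess of \<open>j\<close> is at least \<open>2 * w\<close>, because
      \<open>2 * a i \<le> cs i\<close> and both \<open>cs i\<close> and \<open>cs j\<close> are at
      most \<open>cp i j\<close>.\<close>
    moreover have "m j * (2 * w) \<le> m j * (2 * a j - cs j)"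
      using half cs_le_cp[of i j] cs_le_cp'[of j i] m[of j]
      by (intro mult_left_mono) (auto simp: w_def)
    moreover have "0 < m i * w" using m w by simp
    moreover have "w + cs j - a j \<le> a i"
      using cs_le_cp'[of j i] by (simp add: w_def)
    ultimately have "2 * (m j * w) < a i"
      using w by simp
    then show ?thesis by (simp add: w_def)
  qed
  then have "(\<Sum>j\<in>active a i. m j * (a i + a j - cp i j)) < 2 * (a i / 2)"
    using card i a(2)[of i] by (intro sum_less_double) auto
  then show False
    using a(1)[of i] half by (simp add: dual_map_eq_sum_active)
qed

end

section \<open>Nonnegativity of the complementary primal solution\<close>

text \<open>This is the balance system for \<open>z i\<close> = y/\<lambda>. Complementarity on the
  unit box reduces it to excluding \<open>z i = 0\<close>: there only the at most two other members
  of \<open>A i\<close> contribute, each less than 1/2.\<close>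

lemma nonneg_multiplier:
  fixes m :: "'n::finite \<Rightarrow> real" and A :: "'n \<Rightarrow> 'n set"
  assumes m: "\<And>j. 0 < m j"
    and A: "\<And>i. i \<in> A i" "\<And>i. card (A i - {i}) \<le> 2"
  obtains z where "\<And>i. 0 \<le> z i" "\<And>i. z i \<le> 1"
    "\<And>i. z i * (1 + (\<Sum>j\<in>A i. m j)) + (\<Sum>j\<in>A i. m j * z j) = 1"
proof -
  define L where "L z i = z i * (1 + (\<Sum>j\<in>A i. m j)) + (\<Sum>j\<in>A i. m j * z j)" for z i
  have cont: "continuous_on UNIV (\<lambda>v::real^'n. 1 - L (($) v) i)" for i
    unfolding L_def by (intro continuous_intros)
  obtain z where z: "\<And>i. 0 \<le> z i" "\<And>i. z i \<le> 1"
    "\<And>i. 0 < z i \<Longrightarrow> 0 \<le> 1 - L z i" "\<And>i. z i < 1 \<Longrightarrow> 1 - L z i \<le> 0"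
    using box_complementarity[of "\<lambda>_. 1" "\<lambda>z i. 1 - L z i"] cont
    by (metis zero_le_one)
  have L_ge: "z i * (1 + sum m B) + (\<Sum>j\<in>B. m j * z j) \<le> L z i" if "B \<subseteq> A i" for i B
    unfolding L_def using that m z(1)
    by (intro add_mono mult_left_mono sum_mono2) (auto simp: less_imp_le)
  \<comment> \<open>As \<open>j\<close> lies in \<open>A j\<close>, row \<open>j\<close> contains
    \<open>m j * z j\<close> twice, besides the positive term \<open>z j\<close>.\<close>
  have half: "m j * z j < 1 / 2" for j
  proof (cases "0 < z j")
    case True
    then show ?thesis using L_ge[of "{j}" j] A(1) z(3)[of j] by (simp add: algebra_simps)
  qed (use z(1)[of j] in simp)
  have pos: "0 < z i" for i
  proof (rule ccontr)
    assume "\<not> 0 < z i"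
    then have zi: "z i = 0" using z(1)[of i] by simp
    have "L z i = (\<Sum>j\<in>A i - {i}. m j * z j)"
      using A(1)[of i] zi by (simp add: L_def sum.remove[of "A i" i])
    also have "\<dots> < 2 * (1 / 2)"
      using A(2) half by (intro sum_less_double) auto
    finally show False using z(4)[of i] zi by simp
  qed
  have "L z i = 1" for i
  proof (cases "z i < 1")
    case False
    then have "1 \<le> L z i" using L_ge[of "{}" i] by simp
    then show ?thesis using z(3)[OF pos, of i] by simp
  qed (use z(3)[OF pos, of i] z(4)[of i] in simp)
  then show thesis using that[of z] z(1,2) unfolding L_def by blast
qed

section \<open>Linear programming duality and sparsity of the active sets\<close>

context match_costs
begin

text \<open>Weak duality. The excess of \<open>a i + a j\<close> over \<open>cp i j\<close> is
  charged to \<open>y $ i\<close> through the coupling constraint, and by the dual equation these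
  charges sum to \<open>cs i - a i\<close>.\<close>

lemma lp_cost_ge_dual:
  fixes l :: "real^'n"
  assumes t: "0 < t" and l: "\<And>i. 0 < l $ i"
    and a: "\<And>i. dual_map (\<lambda>j. l $ j / t) a i = cs i"
    and p: "p \<in> lp_feasible (\<lambda>_. t) l"
  shows "(\<Sum>i\<in>UNIV. l $ i * a i) \<le> lp_cost cs cp p"
proof -
  obtain x y where xy: "p = (x, y)" by force
  have bal: "(\<Sum>j\<in>UNIV. x $ j $ i) + (\<Sum>j\<in>UNIV. x $ i $ j) + y $ i = l $ i"
    and cap: "t * x $ i $ j \<le> l $ j * y $ i" and x0: "0 \<le> x $ i $ j" for i j
    using p by (auto simp: lp_feasible_def xy)
  have term_ge: "a i * y $ i + (\<Sum>j\<in>UNIV. (a i + a j) * x $ i $ j)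
      \<le> cs i * y $ i + (\<Sum>j\<in>UNIV. cp i j * x $ i $ j)" for i
  proof -
    have "(a i + a j) * x $ i $ j \<le>
        (l $ j / t * max 0 (a i + a j - cp i j)) * y $ i + cp i j * x $ i $ j" for j
    proof -
      have "(a i + a j - cp i j) * x $ i $ j \<le> max 0 (a i + a j - cp i j) * x $ i $ j"
        using x0 by (intro mult_right_mono) auto
      also have "\<dots> \<le> max 0 (a i + a j - cp i j) * (l $ j * y $ i / t)"
        using cap[of i j] t by (intro mult_left_mono) (auto simp: field_simps)
      finally show ?thesis by (simp add: algebra_simps)
    qed
    then have "(\<Sum>j\<in>UNIV. (a i + a j) * x $ i $ j) \<le>
        (\<Sum>j\<in>UNIV. (l $ j / t * max 0 (a i + a j - cp i j)) * y $ i + cp i j * x $ i $ j)"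
      by (intro sum_mono)
    also have "\<dots> = (cs i - a i) * y $ i + (\<Sum>j\<in>UNIV. cp i j * x $ i $ j)"
    proof -
      have "(\<Sum>j\<in>UNIV. l $ j / t * max 0 (a i + a j - cp i j)) = cs i - a i"
        using a[of i] by (simp add: dual_map_def)
      then show ?thesis by (simp only: sum.distrib flip: sum_distrib_right)
    qed
    finally show ?thesis by (simp add: algebra_simps)
  qed
  have swap: "(\<Sum>i\<in>UNIV. \<Sum>j\<in>UNIV. a i * x $ j $ i) = (\<Sum>i\<in>UNIV. \<Sum>j\<in>UNIV. a j * x $ i $ j)"
    by (rule sum.swap)
  have "(\<Sum>i\<in>UNIV. l $ i * a i) =
      (\<Sum>i\<in>UNIV. a i * y $ i + (\<Sum>j\<in>UNIV. (a i + a j) * x $ i $ j))"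
    by (simp add: bal[symmetric] algebra_simps sum.distrib sum_distrib_left swap)
  also have "\<dots> \<le> (\<Sum>i\<in>UNIV. cs i * y $ i + (\<Sum>j\<in>UNIV. cp i j * x $ i $ j))"
    by (intro sum_mono term_ge)
  also have "\<dots> = lp_cost cs cp p"
    by (simp add: lp_cost_def xy sum.distrib)
  finally show ?thesis .
qed

lemma sum_active_swap:
  fixes F :: "'n \<Rightarrow> 'n \<Rightarrow> real"
  shows "(\<Sum>i\<in>UNIV. \<Sum>j\<in>active a i. F i j) = (\<Sum>i\<in>UNIV. \<Sum>j\<in>active a i. F j i)"
proof -
  have "(\<Sum>j\<in>active a i. H j) = (\<Sum>j\<in>UNIV. if j \<in> active a i then H j else 0)"
    for i and H :: "'n \<Rightarrow> real"
    by (simp add: sum.If_cases)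
  then show ?thesis
    using sum.swap[of "\<lambda>i j. if j \<in> active a i then F i j else 0" UNIV UNIV]
    by (simp add: active_sym)
qed

text \<open>Multiply the balance at \<open>i\<close> by \<open>b i\<close> and sum; symmetry of the
  active relation transposes the incoming flow. The vector \<open>b\<close> is arbitrary because it
  is later the dual solution of a different point.\<close>

lemma balance_pairing:
  fixes l y b :: "'n \<Rightarrow> real"
  assumes bal: "\<And>i. y i * (1 + (\<Sum>j\<in>active a i. l j / t)) + l i / t * (\<Sum>j\<in>active a i. y j) = l i"
  shows "(\<Sum>i\<in>UNIV. l i * b i) =
    (\<Sum>i\<in>UNIV. y i * (b i + (\<Sum>j\<in>active a i. l j / t * (b i + b j))))"
proof -
  have "(\<Sum>i\<in>UNIV. l i * b i) =
      (\<Sum>i\<in>UNIV. y i * b i + (\<Sum>j\<in>active a i. y i * (l j / t) * b i) +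
        (\<Sum>j\<in>active a i. l i / t * y j * b i))"
    by (subst bal[symmetric]) (simp add: algebra_simps sum_distrib_left sum_distrib_right)
  also have "\<dots> = (\<Sum>i\<in>UNIV. y i * b i + (\<Sum>j\<in>active a i. y i * (l j / t) * b i) +
        (\<Sum>j\<in>active a i. l j / t * y i * b j))"
    using sum_active_swap[of "\<lambda>i j. l i / t * y j * b i"] by (simp add: sum.distrib)
  finally show ?thesis
    by (simp add: algebra_simps sum_distrib_left sum.distrib)
qed

text \<open>The coupling constraints are made tight on active pairs and \<open>x\<close> is set to 0
  elsewhere, so complementary slackness matches primal and dual cost. Both expressions are kept:
  frozen patterns compare the dual one at one point with the primal one at another.\<close>

lemma lp_value_eq_dual:
  fixes l :: "real^'n"
  assumes t: "0 < t" and l: "\<And>i. 0 < l $ i"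
    and a: "\<And>i. dual_map (\<lambda>j. l $ j / t) a i = cs i"
    and y: "\<And>i. 0 \<le> y i"
    and bal: "\<And>i. y i * (1 + (\<Sum>j\<in>active a i. l $ j / t)) + l $ i / t * (\<Sum>j\<in>active a i. y j) = l $ i"
  shows "lp_value cs cp (\<lambda>_. t) l = (\<Sum>i\<in>UNIV. l $ i * a i)"
    and "lp_value cs cp (\<lambda>_. t) l =
      (\<Sum>i\<in>UNIV. y i * (cs i + (\<Sum>j\<in>active a i. l $ j / t * cp i j)))"
proof -
  define x :: "real^'n^'n"
    where "x = (\<chi> i j. if j \<in> active a i then l $ j / t * y i else 0)"
  define Y :: "real^'n" where "Y = (\<chi> i. y i)"
  have row: "(\<Sum>j\<in>UNIV. c j * x $ i $ j) = (\<Sum>j\<in>active a i. c j * (l $ j / t * y i))" for i c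
    by (rule sum.mono_neutral_cong_right) (auto simp: x_def)
  have col: "(\<Sum>j\<in>UNIV. x $ j $ i) = (\<Sum>j\<in>active a i. l $ i / t * y j)" for i
    by (rule sum.mono_neutral_cong_right) (auto simp: x_def active_sym[of i])
  have feas: "(x, Y) \<in> lp_feasible (\<lambda>_. t) l"
    unfolding lp_feasible_def
  proof (clarify, intro conjI allI)
    fix i j
    show "(\<Sum>j\<in>UNIV. x $ j $ i) + (\<Sum>j\<in>UNIV. x $ i $ j) + Y $ i = l $ i"
      using bal[of i] row[of "\<lambda>_. 1" i]
      by (simp add: col Y_def algebra_simps sum_distrib_left)
    show "t * x $ i $ j \<le> l $ j * Y $ i" "0 \<le> x $ i $ j" "0 \<le> Y $ i"
      using t l[of j] y by (auto simp: x_def Y_def)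
  qed
  have cost_eq: "lp_cost cs cp (x, Y) =
      (\<Sum>i\<in>UNIV. y i * (cs i + (\<Sum>j\<in>active a i. l $ j / t * cp i j)))"
    by (simp add: lp_cost_def row Y_def sum.distrib sum_distrib_left algebra_simps)
  have "cs i + (\<Sum>j\<in>active a i. l $ j / t * cp i j) =
      a i + (\<Sum>j\<in>active a i. l $ j / t * (a i + a j))" for i
    using a[of i] unfolding dual_map_eq_sum_active
    by (simp add: right_diff_distrib sum_subtractf)
  then have cost: "lp_cost cs cp (x, Y) = (\<Sum>i\<in>UNIV. l $ i * a i)"
    using balance_pairing[where y = y and a = a and l = "($) l" and t = t and b = a] bal cost_eq
    by simp
  show val: "lp_value cs cp (\<lambda>_. t) l = (\<Sum>i\<in>UNIV. l $ i * a i)"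
    unfolding lp_value_def
  proof (rule antisym)
    have "bdd_below (lp_cost cs cp ` lp_feasible (\<lambda>_. t) l)"
      using lp_cost_ge_dual[OF t l a] by (intro bdd_belowI2)
    then show "(INF p\<in>lp_feasible (\<lambda>_. t) l. lp_cost cs cp p) \<le> (\<Sum>i\<in>UNIV. l $ i * a i)"
      using feas cost by (metis cINF_lower)
    show "(\<Sum>i\<in>UNIV. l $ i * a i) \<le> (INF p\<in>lp_feasible (\<lambda>_. t) l. lp_cost cs cp p)"
      using feas lp_cost_ge_dual[OF t l a] by (intro cINF_greatest) auto
  qed
  show "lp_value cs cp (\<lambda>_. t) l =
      (\<Sum>i\<in>UNIV. y i * (cs i + (\<Sum>j\<in>active a i. l $ j / t * cp i j)))"
    using val cost cost_eq by simp
qed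

lemma active_subset_efficient:
  assumes m: "\<And>j. 0 < m j" and a: "\<And>i. dual_map m a i = cs i"
    and e: "e < 1 / 2" "\<And>j. e / (1 - 2 * e) < m j"
  shows "active a i \<subseteq> {j. e < match_eff cs cp i j}"
proof -
  have a_less: "a i < (1 - e) * cs i" for i
  proof -
    have "a i * (1 + 2 * m i) \<le> cs i * (1 + m i)"
      using dual_map_ge[of m a i "{i}"] m a[of i]
      by (simp add: less_imp_le cs_diag algebra_simps)
    \<comment> \<open>Expanded, this is \<open>e < m i * (1 - 2 * e)\<close>, the assumed lower
      bound on \<open>m i\<close>.\<close>
    moreover have "1 + m i < (1 - e) * (1 + 2 * m i)"
      using e(1) e(2)[of i] by (simp add: field_simps)
    then have "cs i * (1 + m i) < cs i * ((1 - e) * (1 + 2 * m i))"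
      using cs_pos by (rule mult_strict_left_mono)
    ultimately have "a i * (1 + 2 * m i) < ((1 - e) * cs i) * (1 + 2 * m i)"
      by (simp add: mult_ac)
    then show ?thesis using m[of i] by (simp add: mult_less_cancel_right)
  qed
  have "e < match_eff cs cp i j" if "cp i j < a i + a j" for j
  proof -
    have "cp i j < (1 - e) * (cs i + cs j)"
      using that a_less[of i] a_less[of j] by (simp add: algebra_simps)
    then show ?thesis
      using cs_pos[of i] cs_pos[of j] by (simp add: match_eff_def field_simps)
  qed
  then show ?thesis by (auto simp: active_def)
qed

text \<open>The last conjunct is the balance constraint for the complementary primal point, in which
  $x_{i,j} = \lambda_j y_i / \theta$ for active \<open>j\<close> and $x_{i,j} = 0$ otherwise.\<close>

definition dual_optimal :: "real \<Rightarrow> ('n \<Rightarrow> real) \<Rightarrow> ('n \<Rightarrow> real) \<Rightarrow> ('n \<Rightarrow> real) \<Rightarrow> bool"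
  where "dual_optimal t l a y \<longleftrightarrow>
    (\<forall>i. dual_map (\<lambda>j. l j / t) a i = cs i) \<and> (\<forall>i. 0 < a i \<and> a i \<le> cs i) \<and>
    (\<forall>i. 0 \<le> y i \<and> y i \<le> l i) \<and>
    (\<forall>i. y i * (1 + (\<Sum>j\<in>active a i. l j / t)) + l i / t * (\<Sum>j\<in>active a i. y j) = l i)"

lemma dual_optimal_exists:
  assumes t: "0 < t" and l: "\<And>i. 0 < l i"
    and sparse: "\<And>a i. (\<And>i. dual_map (\<lambda>j. l j / t) a i = cs i) \<Longrightarrow> card (active a i - {i}) \<le> 2"
  obtains a y where "dual_optimal t l a y"
proof -
  have m: "0 < l j / t" for j using t l by simp
  obtain a where a: "\<And>i. dual_map (\<lambda>j. l j / t) a i = cs i" "\<And>i. 0 < a i" "\<And>i. a i \<le> cs i"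
    using dual_map_solution[of "\<lambda>j. l j / t"] m by (metis less_imp_le)
  have card: "card (active a i - {i}) \<le> 2" for i using sparse a(1) by blast
  have "i \<in> active a i" for i using self_active[OF m a(1,2) card] .
  then obtain z where z: "\<And>i. 0 \<le> z i" "\<And>i. z i \<le> 1"
    "\<And>i. z i * (1 + (\<Sum>j\<in>active a i. l j / t)) + (\<Sum>j\<in>active a i. l j / t * z j) = 1"
    using nonneg_multiplier[of "\<lambda>j. l j / t" "active a"] m card by metis
  \<comment> \<open>Scaling the normalised system by \<open>l i\<close> restores the balance
    equation.\<close>
  have "dual_optimal t l a (\<lambda>i. l i * z i)"
    unfolding dual_optimal_def
  proof (intro conjI allI)
    fix i
    show "l i * z i * (1 + (\<Sum>j\<in>active a i. l j / t)) +
        l i / t * (\<Sum>j\<in>active a i. l j * z j) = l i"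
      using arg_cong[OF z(3)[of i], of "\<lambda>u. l i * u"]
      by (simp add: algebra_simps sum_distrib_left)
    show "l i * z i \<le> l i" "0 \<le> l i * z i"
      using z(1,2)[of i] l[of i] by (auto simp: mult_left_le)
  qed (use a in auto)
  then show thesis by (rule that)
qed

section \<open>Lipschitz dual solutions and the quadratic upper bound\<close>

text \<open>Insert \<open>a'\<close> into the equation at \<open>l\<close>: its residual is linear
  in \<open>l - l'\<close>, with coefficients at most \<open>sum cs UNIV / t\<close> for every row.
  Expansiveness then transfers the bound to \<open>a - a'\<close>.\<close>

lemma dual_optimal_lipschitz:
  fixes l l' :: "real^'n"
  assumes t: "0 < t" and l: "\<And>i. 0 < l $ i"
    and "dual_optimal t (($) l) a y" "dual_optimal t (($) l') a' y'"
  shows "\<bar>a i - a' i\<bar> \<le> real CARD('n) * (\<Sum>i\<in>UNIV. cs i) / t * norm (l - l')"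
proof (rule dual_map_expansive)
  show "0 \<le> l $ j / t" for j using l[of j] t by simp
  fix k
  have a: "dual_map (\<lambda>j. l $ j / t) a k = cs k"
    and a': "dual_map (\<lambda>j. l' $ j / t) a' k = cs k" "\<And>i. a' i \<le> cs i"
    using assms by (auto simp: dual_optimal_def)
  let ?w = "\<lambda>j. max 0 (a' k + a' j - cp k j)"
  have "0 < sum cs UNIV" by (intro sum_pos) (auto simp: cs_pos)
  have w: "?w j \<le> sum cs UNIV" for j
  proof -
    have "?w j \<le> cs k"
      using a'(2)[of k] a'(2)[of j] cs_le_cp'[of j k] cs_pos[of k] by linarith
    also have "\<dots> \<le> sum cs UNIV"
      using cs_pos by (intro member_le_sum) (auto simp: less_imp_le)
    finally show ?thesis .
  qed
  have "\<bar>dual_map (\<lambda>j. l $ j / t) a k - dual_map (\<lambda>j. l $ j / t) a' k\<bar> =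
      \<bar>\<Sum>j\<in>UNIV. (l - l') $ j / t * ?w j\<bar>"
    using a a'(1) unfolding dual_map_def
    by (simp add: diff_divide_distrib left_diff_distrib sum_subtractf)
  also have "\<dots> \<le> (\<Sum>j\<in>UNIV. \<bar>(l - l') $ j / t * ?w j\<bar>)"
    by (rule sum_abs)
  also have "\<dots> \<le> (\<Sum>j\<in>(UNIV::'n set). norm (l - l') / t * sum cs UNIV)"
    using w t component_le_norm_cart[of "l - l'"]
    by (intro sum_mono) (auto simp: abs_mult intro!: mult_mono divide_right_mono)
  finally show "\<bar>dual_map (\<lambda>j. l $ j / t) a k - dual_map (\<lambda>j. l $ j / t) a' k\<bar>
      \<le> real CARD('n) * sum cs UNIV / t * norm (l - l')"
    by (simp add: mult_ac)
qed

lemma lp_value_dual_optimal: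
  fixes l :: "real^'n"
  assumes "0 < t" "\<And>i. 0 < l $ i" "dual_optimal t (($) l) a y"
  shows "lp_value cs cp (\<lambda>_. t) l = (\<Sum>i\<in>UNIV. l $ i * a i)"
    and "lp_value cs cp (\<lambda>_. t) l =
      (\<Sum>i\<in>UNIV. y i * (cs i + (\<Sum>j\<in>active a i. l $ j / t * cp i j)))"
  using lp_value_eq_dual[of t l a y] assms by (auto simp: dual_optimal_def)

text \<open>Weight the dual inequality at \<open>l\<close>, restricted to the active sets of
  \<open>a'\<close>, by \<open>y'\<close>, and pair the balance at \<open>l'\<close> with
  \<open>a\<close>. The terms without \<open>l - l'\<close> combine into the value at
  \<open>l'\<close>.\<close>

lemma lp_value_frozen_pattern:
  fixes l l' :: "real^'n"
  assumes t: "0 < t" and l: "\<And>i. 0 < l $ i" "\<And>i. 0 < l' $ i"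
    and opt: "dual_optimal t (($) l) a y" and opt': "dual_optimal t (($) l') a' y'"
  shows "lp_value cs cp (\<lambda>_. t) l \<le> lp_value cs cp (\<lambda>_. t) l' +
    ((\<Sum>i\<in>UNIV. (l - l') $ i * a i) -
     (\<Sum>i\<in>UNIV. \<Sum>j\<in>active a' i. y' i * ((l - l') $ j / t * (a i + a j - cp i j))))"
proof -
  have y': "0 \<le> y' i" for i using opt' by (simp add: dual_optimal_def)
  have "y' i * (a i + (\<Sum>j\<in>active a' i. l $ j / t * (a i + a j - cp i j))) \<le> y' i * cs i" for i
    using dual_map_ge[of "\<lambda>j. l $ j / t" a i "active a' i"] opt t l(1) y'
    by (intro mult_left_mono) (auto simp: dual_optimal_def less_imp_le)
  then have 1: "(\<Sum>i\<in>UNIV. y' i * (a i + (\<Sum>j\<in>active a' i. l $ j / t * (a i + a j - cp i j))))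
      \<le> (\<Sum>i\<in>UNIV. y' i * cs i)"
    by (intro sum_mono)
  have 2: "(\<Sum>i\<in>UNIV. l' $ i * a i) =
      (\<Sum>i\<in>UNIV. y' i * (a i + (\<Sum>j\<in>active a' i. l' $ j / t * (a i + a j))))"
    using opt' by (intro balance_pairing) (auto simp: dual_optimal_def)
  show ?thesis
    unfolding lp_value_dual_optimal(1)[OF t l(1) opt] lp_value_dual_optimal(2)[OF t l(2) opt']
    using 1 2
    by (simp add: algebra_simps sum.distrib sum_subtractf sum_distrib_left
        diff_divide_distrib add_divide_distrib)
qed

lemma lp_value_quadratic_upper:
  fixes l l' hi :: "real^'n" and t :: real
  defines "K \<equiv> real CARD('n) * (\<Sum>i\<in>UNIV. cs i) / t"
  defines "R \<equiv> real CARD('n) * K + 2 * K / t * real CARD('n) * (\<Sum>i\<in>UNIV. hi $ i)"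
  assumes t: "0 < t" and l: "\<And>i. 0 < l $ i" "\<And>i. 0 < l' $ i" and hi: "\<And>i. l' $ i \<le> hi $ i"
    and opt: "dual_optimal t (($) l) a y" and opt': "dual_optimal t (($) l') a' y'"
  shows "lp_value cs cp (\<lambda>_. t) l \<le> lp_value cs cp (\<lambda>_. t) l' +
    (\<chi> i. a' i - (\<Sum>j\<in>active a' i. y' j * (a' j + a' i - cp j i)) / t) \<bullet> (l - l') +
    R * (norm (l - l'))\<^sup>2"
proof -
  define d where "d = l - l'"
  define D where "D = norm d"
  define E where "E b = (\<Sum>i\<in>UNIV. d $ i * b i) -
     (\<Sum>i\<in>UNIV. \<Sum>j\<in>active a' i. y' i * (d $ j / t * (b i + b j - cp i j)))" for b
  define \<Delta> where "\<Delta> i = a i - a' i" for i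
  have y': "0 \<le> y' i" "y' i \<le> hi $ i" for i
    using opt' hi[of i] by (auto simp: dual_optimal_def intro: order_trans)
  have d: "\<bar>d $ i\<bar> \<le> D" for i
    unfolding D_def by (rule component_le_norm_cart)
  have "0 \<le> D" by (simp add: D_def)
  have "0 \<le> K"
    using t cs_pos
    by (auto simp: K_def less_imp_le
        intro!: divide_nonneg_pos mult_nonneg_nonneg sum_nonneg)
  have \<Delta>: "\<bar>\<Delta> i\<bar> \<le> K * D" for i
    using dual_optimal_lipschitz[OF t l(1) opt opt', of i] by (simp add: \<Delta>_def K_def D_def d_def)
  have "E a' = (\<Sum>i\<in>UNIV. d $ i * a' i) -
     (\<Sum>i\<in>UNIV. \<Sum>j\<in>active a' i. y' j * (d $ i / t * (a' j + a' i - cp j i)))"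
    unfolding E_def by (subst sum_active_swap) rule
  also have "\<dots> = (\<chi> i. a' i - (\<Sum>j\<in>active a' i. y' j * (a' j + a' i - cp j i)) / t) \<bullet> d"
    by (simp add: inner_vec_def algebra_simps sum_subtractf sum.distrib sum_distrib_left
        sum_divide_distrib diff_divide_distrib add_divide_distrib)
  finally have linear: "E a' = (\<chi> i. a' i - (\<Sum>j\<in>active a' i. y' j * (a' j + a' i - cp j i)) / t) \<bullet> d" .
  have "E a - E a' = (\<Sum>i\<in>UNIV. d $ i * \<Delta> i) -
     (\<Sum>i\<in>UNIV. \<Sum>j\<in>active a' i. y' i * (d $ j / t * (\<Delta> i + \<Delta> j)))"
    unfolding E_def \<Delta>_def
    by (simp add: algebra_simps sum.distrib sum_subtractf diff_divide_distrib add_divide_distrib)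
  \<comment> \<open>The bound \<open>y' i \<le> hi $ i\<close> makes the constant the same for all
    points of the box.\<close>
  also have "\<dots> \<le> (\<Sum>i\<in>(UNIV::'n set). D * (K * D)) +
     (\<Sum>i\<in>UNIV. \<Sum>j\<in>(UNIV::'n set). hi $ i * (D / t * (2 * (K * D))))"
  proof -
    have "d $ i * \<Delta> i \<le> D * (K * D)" for i
    proof -
      have "d $ i * \<Delta> i \<le> \<bar>d $ i\<bar> * \<bar>\<Delta> i\<bar>" by (simp flip: abs_mult)
      also have "\<dots> \<le> D * (K * D)" using d \<Delta> \<open>0 \<le> D\<close> by (intro mult_mono) auto
      finally show ?thesis .
    qed
    then have 1: "(\<Sum>i\<in>UNIV. d $ i * \<Delta> i) \<le> (\<Sum>i\<in>(UNIV::'n set). D * (K * D))"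
      by (intro sum_mono)
    have "- (y' i * (d $ j / t * (\<Delta> i + \<Delta> j))) \<le> hi $ i * (D / t * (2 * (K * D)))" for i j
    proof -
      have "- (y' i * (d $ j / t * (\<Delta> i + \<Delta> j))) \<le> \<bar>y' i * (d $ j / t * (\<Delta> i + \<Delta> j))\<bar>"
        by (rule abs_ge_minus_self)
      also have "\<dots> = y' i * (\<bar>d $ j\<bar> / t * \<bar>\<Delta> i + \<Delta> j\<bar>)"
        using y'(1) t by (simp add: abs_mult)
      also have "\<dots> \<le> hi $ i * (D / t * (2 * (K * D)))"
      proof (intro mult_mono divide_right_mono)
        show "\<bar>\<Delta> i + \<Delta> j\<bar> \<le> 2 * (K * D)" using \<Delta>[of i] \<Delta>[of j] by linarith
        show "0 \<le> hi $ i" using y'[of i] by linarith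
      qed (use y' d t \<open>0 \<le> D\<close> in auto)
      finally show ?thesis .
    qed
    then have "(\<Sum>j\<in>active a' i. - (y' i * (d $ j / t * (\<Delta> i + \<Delta> j)))) \<le>
        (\<Sum>j\<in>active a' i. hi $ i * (D / t * (2 * (K * D))))" for i
      by (intro sum_mono)
    also have "(\<Sum>j\<in>active a' i. hi $ i * (D / t * (2 * (K * D)))) \<le>
        (\<Sum>j\<in>(UNIV::'n set). hi $ i * (D / t * (2 * (K * D))))" for i
      using order_trans[OF y'] t \<open>0 \<le> D\<close> \<open>0 \<le> K\<close> by (intro sum_mono2) auto
    finally have "(\<Sum>i\<in>UNIV. \<Sum>j\<in>active a' i. - (y' i * (d $ j / t * (\<Delta> i + \<Delta> j)))) \<le>
        (\<Sum>i\<in>UNIV. \<Sum>j\<in>(UNIV::'n set). hi $ i * (D / t * (2 * (K * D))))"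
      by (intro sum_mono)
    with 1 show ?thesis by (simp add: sum_negf)
  qed
  also have "\<dots> = R * D\<^sup>2"
    by (simp add: R_def power2_eq_square algebra_simps sum_distrib_left sum_divide_distrib)
  finally have "E a \<le> E a' + R * D\<^sup>2" by simp
  then show ?thesis
    using lp_value_frozen_pattern[OF t l opt opt'] linear
    by (simp add: E_def D_def d_def)
qed

end

section \<open>Counting active pairs on the box and assembling the bound\<close>

theorem theorem1:
  fixes cs :: "'n::finite \<Rightarrow> real"
    and cp :: "'n \<Rightarrow> 'n \<Rightarrow> real"
    and \<theta> :: "'n \<Rightarrow> real"
    and \<theta>\<^sub>0 :: real
    and lo hi :: "real ^ 'n"
  assumes cs_pos: "\<And>i. 0 < cs i"
    and cp_pos: "\<And>i j. 0 < cp i j"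
    and cs_diag: "\<And>i. cs i = cp i i"
    and cs_le_cp: "\<And>i j. cs i \<le> cp i j"
    and cp_sym: "\<And>i j. cp i j = cp j i"
    and \<theta>_pos: "\<And>i. 0 < \<theta> i"
    and lo_pos: "\<And>i. 0 < lo $ i"
    and eff_less_half: "\<And>k. 2 \<le> k \<Longrightarrow> crit_match_eff cs cp k < 1 / 2"
    and \<theta>_homogeneous: "\<And>i. \<theta> i = \<theta>\<^sub>0"
    and lo_bound: "\<And>i. lo $ i > \<theta>\<^sub>0 * (crit_match_eff cs cp 4 / (1 - 2 * crit_match_eff cs cp 4))"
  shows "weakly_concave_on (cbox lo hi) (lp_value cs cp \<theta>)"
proof -
  interpret match_costs cs cp
    using cs_pos cs_diag cs_le_cp cp_sym by unfold_locales
  define e where "e = crit_match_eff cs cp 4"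
  have e: "e < 1 / 2" using eff_less_half[of 4] by (simp add: e_def)
  have t: "0 < \<theta>\<^sub>0" using \<theta>_pos \<theta>_homogeneous by metis
  have \<theta>: "\<theta> = (\<lambda>_. \<theta>\<^sub>0)" using \<theta>_homogeneous by auto
  have pos: "0 < l $ i" if "l \<in> cbox lo hi" for l i
    using that lo_pos[of i] by (auto simp: mem_box_cart intro: less_le_trans)
  have opt: "\<exists>a y. dual_optimal \<theta>\<^sub>0 (($) l) a y" if "l \<in> cbox lo hi" for l
  proof -
    have "card (active a i - {i}) \<le> 2" if a: "\<And>i. dual_map (\<lambda>j. l $ j / \<theta>\<^sub>0) a i = cs i" for a i
    proof (cases "4 \<le> CARD('n)")
      case True
      let ?J = "{j. e < match_eff cs cp i j}"
      have "\<theta>\<^sub>0 * (e / (1 - 2 * e)) < l $ j" for j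
        using lo_bound[of j] \<open>l \<in> cbox lo hi\<close> unfolding e_def
        by (meson less_le_trans mem_box_cart(2))
      then have "e / (1 - 2 * e) < l $ j / \<theta>\<^sub>0" for j
        using t by (simp add: pos_less_divide_eq mult.commute)
      then have "active a i \<subseteq> ?J"
        using pos[OF \<open>l \<in> cbox lo hi\<close>] t a e
        by (intro active_subset_efficient[of "\<lambda>j. l $ j / \<theta>\<^sub>0"]) auto
      then have "card (active a i - {i}) \<le> card (?J - {i})"
        by (intro card_mono) auto
      \<comment> \<open>The index \<open>i\<close> lies in \<open>?J\<close>, since its efficiency
        with itself is 1/2, which exceeds \<open>e\<close>. At most three indices exceed the fourth
        critical efficiency, which leaves two.\<close>
      also have "\<dots> = card ?J - 1"
        using e cs_pos[of i] by (subst card_Diff_singleton) (auto simp: match_eff_def simp flip: cs_diag)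
      also have "\<dots> \<le> 2"
        using card_greater_crit_match_eff[of cs cp 3 e i] True by (simp add: e_def)
      finally show ?thesis .
    next
      case False
      \<comment> \<open>With at most three indices in all, only two can differ from
        \<open>i\<close>.\<close>
      have "card (active a i - {i}) \<le> card (UNIV - {i})" by (intro card_mono) auto
      also have "\<dots> \<le> 2" using False by (simp add: card_Diff_singleton)
      finally show ?thesis .
    qed
    then show ?thesis
      using dual_optimal_exists[OF t, of "($) l"] pos[OF \<open>l \<in> cbox lo hi\<close>] by metis
  qed
  define K where "K = real CARD('n) * (\<Sum>i\<in>UNIV. cs i) / \<theta>\<^sub>0"
  define R where "R = real CARD('n) * K + 2 * K / \<theta>\<^sub>0 * real CARD('n) * (\<Sum>i\<in>UNIV. hi $ i)"
  show ?thesis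
  proof (cases "cbox lo hi = {}")
    \<comment> \<open>For an empty box \<open>hi\<close> may have negative entries and
      \<open>R\<close> may be negative, so the constant 0 is used.\<close>
    case True
    then show ?thesis by (intro weakly_concave_onI[of _ 0]) auto
  next
    case False
    then obtain l where l: "l \<in> cbox lo hi" by blast
    have "0 < hi $ i" for i
      using pos[OF l, of i] l by (auto simp: mem_box_cart intro: less_le_trans)
    then have "0 \<le> R"
      using t cs_pos
      by (auto simp: R_def K_def less_imp_le
          intro!: add_nonneg_nonneg mult_nonneg_nonneg divide_nonneg_pos sum_nonneg)
    moreover have "\<exists>g. \<forall>l\<in>cbox lo hi. lp_value cs cp \<theta> l \<le>
        lp_value cs cp \<theta> l' + g \<bullet> (l - l') + R * (norm (l - l'))\<^sup>2" if l': "l' \<in> cbox lo hi" for l'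
    proof -
      obtain a' y' where opt': "dual_optimal \<theta>\<^sub>0 (($) l') a' y'" using opt[OF l'] by blast
      have "lp_value cs cp \<theta> l \<le> lp_value cs cp \<theta> l' +
          (\<chi> i. a' i - (\<Sum>j\<in>active a' i. y' j * (a' j + a' i - cp j i)) / \<theta>\<^sub>0) \<bullet> (l - l') +
          R * (norm (l - l'))\<^sup>2" if l: "l \<in> cbox lo hi" for l
      proof -
        obtain a y where "dual_optimal \<theta>\<^sub>0 (($) l) a y" using opt[OF l] by blast
        then show ?thesis
          using lp_value_quadratic_upper[OF t pos[OF l] pos[OF l'] _ _ opt', of hi a y] l'
          unfolding \<theta> R_def K_def by (simp add: mem_box_cart)
      qed
      then show ?thesis by blast
    qed
    ultimately show ?thesis
      by (intro weakly_concave_onI[of _ R]) auto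
  qed
qed

end
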